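(* Let $n\ge1$, $N=2n+1$, and let $D$ be the diagram of the $(2,2n+1)$-torus knot obtained as the closure of the 2-strand braid with $N$ positive crossings, with segments labelled $x_1,\dots,x_N$ (top) and $y_1,\dots,y_N$ (bottom) as in the context. Let $m\in\mathbb C\setminus\{0\}$. The $b$-variables of the non-pinched $\chi$-colorings of $D$ with meridian eigenvalue $m$ are given by $$x_i=\frac{q\sqrt\Lambda\,\mathrm{Fib}_{i-1}(\sqrt\Lambda)+pr\,\mathrm{Fib}_i(\sqrt\Lambda)}{r\,\mathrm{Fib}_{i-2}(\sqrt\Lambda)+\sqrt\Lambda\,\mathrm{Fib}_{i-1}(\sqrt\Lambda)},\qquad y_i=\frac1m\,\frac{q\sqrt\Lambda\,\mathrm{Fib}_{i-2}(\sqrt\Lambda)+pr\,\mathrm{Fib}_{i-1}(\sqrt\Lambda)}{r\,\mathrm{Fib}_{i-1}(\sqrt\Lambda)+\sqrt\Lambda\,\mathrm{Fib}_i(\sqrt\Lambda)}$$ for $1\le i\le N$, where $\Lambda\in\mathbb C$ satisfies $$\sum_{0\le j\le n}\binom{2n-j}{j}\Lambda^{n-j}=0$$ and $p=x_1$, $q=my_1$, $r=(x_2-my_1)/x_1$ are arbitrary nonzero parameters such that the crossings are not pinched and all $b$-variables are finite and nonzero. That is: every non-pinched $\chi$-coloring of $D$ with all meridian eigenvalues $m$ has $b$-variables of this form for some such $\Lambda,p,q,r$, and conversely every such choice of $\Lambda,p,q,r$ gives the $b$-variables of a $\chi$-coloring. The expressions for $x_i,y_i$ depend only on $\Lambda$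 and not on the choice of $\sqrt\Lambda$.
   Context: **Crossings.** Each crossing is drawn with both strands running left to right: incoming segments $1$ (top left), $2$ (bottom left); outgoing segments $2'$ (top right), $1'$ (bottom right); strands run $1\to1'$ and $2\to2'$; at a positive crossing $1\to1'$ passes over. In $D$ the $i$-th crossing has incoming segments $1=x_i$, $2=y_i$ and outgoing segments $2'=x_{i+1}$, $1'=y_{i+1}$, with indices mod $N$ (so $x_{N+1}=x_1$, $y_{N+1}=y_1$). We use $x_i,y_i$ also for the $b$-variables of these segments. **$\chi$-colorings.** A $\chi$-coloring assigns to each segment a triple $(a,b,m)\in(\mathbb C\setminus\{0\})^3$ so that at each positive crossing $m_{1'}=m_1$, $m_{2'}=m_2$, $a_{1'}=a_1A^{-1}$, $a_{2'}=a_2A$ with $A=1-\frac{m_1b_1}{b_2}(1-\frac{a_1}{m_1})(1-\frac1{m_2a_2})$, and $$b_{1'}=\tfrac{m_2b_2}{m_1}\bigl(1-m_2a_2(1-\tfrac{b_2}{m_1b_1})\bigr)^{-1},\quad b_{2'}=b_1\bigl(1-\tfrac{m_1}{a_1}(1-\tfrac{b_2}{m_1b_1})\bigr).$$ For a knot all segments have the same $m$, called the meridian eigenvalue. A crossing is pinched if any of $b_2=m_1b_1$, $m_2b_2=m_1b_{1'}$, $b_{2'}=b_1$, $m_2b_{2'}=b_{1'}$ holds; a $\chi$-coloring is non-pinched if no crossing is pinched. **Fibonacci polynomials.** $\mathrm{Fib}_i(W)$, $i\in\mathbb Z$, is defined by $\mathrm{Fib}_0=0$, $\mathrm{Fib}_1=1$,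 $\mathrm{Fib}_{i+1}(W)=W\,\mathrm{Fib}_i(W)+\mathrm{Fib}_{i-1}(W)$ (so $\mathrm{Fib}_{-1}=1$). *)

theory Defs
  imports Complex_Main "HOL-Computational_Algebra.Polynomial"
begin

text \<open>
  A positive crossing, listed by its segments: incoming \<open>1\<close> (top left) and \<open>2\<close> (bottom left),
  outgoing \<open>2'\<close> (top right) and \<open>1'\<close> (bottom right).  A diagram with positive crossings only is
  represented by its set of crossings.
\<close>

datatype 's crossing = PosCrossing (seg1: 's) (seg2: 's) (seg2': 's) (seg1': 's)

definition segments :: "'s crossing set \<Rightarrow> 's set" where
  "segments D = (\<Union>k\<in>D. {seg1 k, seg2 k, seg2' k, seg1' k})"

text \<open>
  An assignment of triples \<open>(a,b,m)\<close> to segments is given by its three component functions, of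
  which only the values on \<open>segments D\<close> matter.  The conditions that \<open>A\<close> and the other factor
  that is inverted are nonzero are stated explicitly because \<open>inverse 0 = 0\<close>.
\<close>

definition chi_crossing ::
  "('s \<Rightarrow> complex) \<Rightarrow> ('s \<Rightarrow> complex) \<Rightarrow> ('s \<Rightarrow> complex) \<Rightarrow> 's crossing \<Rightarrow> bool" where
  "chi_crossing a b m k \<longleftrightarrow>
    (let a1 = a (seg1 k); a2 = a (seg2 k); a2' = a (seg2' k); a1' = a (seg1' k);
         b1 = b (seg1 k); b2 = b (seg2 k); b2' = b (seg2' k); b1' = b (seg1' k);
         m1 = m (seg1 k); m2 = m (seg2 k); m2' = m (seg2' k); m1' = m (seg1' k);
         A = 1 - m1 * b1 / b2 * (1 - a1 / m1) * (1 - 1 / (m2 * a2));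
         B = 1 - m2 * a2 * (1 - b2 / (m1 * b1))
     in A \<noteq> 0 \<and> B \<noteq> 0 \<and> m1' = m1 \<and> m2' = m2 \<and>
        a1' = a1 * inverse A \<and> a2' = a2 * A \<and>
        b1' = m2 * b2 / m1 * inverse B \<and>
        b2' = b1 * (1 - m1 / a1 * (1 - b2 / (m1 * b1))))"

definition chi_coloring ::
  "'s crossing set \<Rightarrow> ('s \<Rightarrow> complex) \<Rightarrow> ('s \<Rightarrow> complex) \<Rightarrow> ('s \<Rightarrow> complex) \<Rightarrow> bool" where
  "chi_coloring D a b m \<longleftrightarrow>
    (\<forall>\<sigma>\<in>segments D. a \<sigma> \<noteq> 0 \<and> b \<sigma> \<noteq> 0 \<and> m \<sigma> \<noteq> 0) \<and> (\<forall>k\<in>D. chi_crossing a b m k)"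

definition pinched :: "('s \<Rightarrow> complex) \<Rightarrow> ('s \<Rightarrow> complex) \<Rightarrow> 's crossing \<Rightarrow> bool" where
  "pinched b m k \<longleftrightarrow>
    b (seg2 k) = m (seg1 k) * b (seg1 k) \<or>
    m (seg2 k) * b (seg2 k) = m (seg1 k) * b (seg1' k) \<or>
    b (seg2' k) = b (seg1 k) \<or>
    m (seg2 k) * b (seg2' k) = b (seg1' k)"

definition non_pinched :: "'s crossing set \<Rightarrow> ('s \<Rightarrow> complex) \<Rightarrow> ('s \<Rightarrow> complex) \<Rightarrow> bool" where
  "non_pinched D b m \<longleftrightarrow> (\<forall>k\<in>D. \<not> pinched b m k)"

datatype torus_seg = X nat | Y nat

text \<open>
  The closure of the 2-strand braid with \<open>N = 2 * n + 1\<close> positive crossings.  Segments carry the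
  indices \<open>1, \<dots>, N\<close>; the cyclic successor of \<open>i\<close> in this range is \<open>i mod N + 1\<close>.
\<close>

definition torus_diagram :: "nat \<Rightarrow> torus_seg crossing set" where
  "torus_diagram n = (let N = 2 * n + 1 in
    (\<lambda>i. PosCrossing (X i) (Y i) (X (i mod N + 1)) (Y (i mod N + 1))) ` {1..N})"

function fib_poly :: "int \<Rightarrow> complex poly" where
  "fib_poly i =
    (if i = 0 then 0
     else if i = 1 then 1
     else if i > 1 then [:0, 1:] * fib_poly (i - 1) + fib_poly (i - 2)
     else fib_poly (i + 2) - [:0, 1:] * fib_poly (i + 1))"
  by auto
termination
  by (relation "measure (\<lambda>i. nat \<bar>2 * i - 1\<bar>)") auto

declare fib_poly.simps [simp del]

lemma fib_poly_0 [simp]: "fib_poly 0 = 0" and fib_poly_1 [simp]: "fib_poly 1 = 1"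
  by (simp_all add: fib_poly.simps)

lemma fib_poly_rec: "fib_poly (i + 1) = [:0, 1:] * fib_poly i + fib_poly (i - 1)"
proof (cases "i \<ge> 1")
  case True
  then show ?thesis by (subst fib_poly.simps) simp
next
  case False
  then have "fib_poly (i - 1) = fib_poly (i + 1) - [:0, 1:] * fib_poly i"
    by (subst fib_poly.simps) (simp add: add.commute)
  then show ?thesis by simp
qed

abbreviation Fib :: "int \<Rightarrow> complex \<Rightarrow> complex" where
  "Fib i w \<equiv> poly (fib_poly i) w"

definition Lambda_eq :: "nat \<Rightarrow> complex \<Rightarrow> bool" where
  "Lambda_eq n \<Lambda> \<longleftrightarrow> (\<Sum>j = 0..n. of_nat ((2 * n - j) choose j) * \<Lambda> ^ (n - j)) = 0"

text \<open>The parameter \<open>s\<close> stands for a square root of \<open>\<Lambda>\<close>.\<close>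

fun torus_num :: "complex \<Rightarrow> complex \<Rightarrow> complex \<Rightarrow> complex \<Rightarrow> torus_seg \<Rightarrow> complex" where
  "torus_num s p q r (X i) = q * s * Fib (int i - 1) s + p * r * Fib (int i) s"
| "torus_num s p q r (Y i) = q * s * Fib (int i - 2) s + p * r * Fib (int i - 1) s"

fun torus_den :: "complex \<Rightarrow> complex \<Rightarrow> torus_seg \<Rightarrow> complex" where
  "torus_den s r (X i) = r * Fib (int i - 2) s + s * Fib (int i - 1) s"
| "torus_den s r (Y i) = r * Fib (int i - 1) s + s * Fib (int i) s"

fun torus_b :: "complex \<Rightarrow> complex \<Rightarrow> complex \<Rightarrow> complex \<Rightarrow> complex \<Rightarrow> torus_seg \<Rightarrow> complex" where
  "torus_b m s p q r (X i) = torus_num s p q r (X i) / torus_den s r (X i)"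
| "torus_b m s p q r (Y i) = 1 / m * (torus_num s p q r (Y i) / torus_den s r (Y i))"

text \<open>
  The conditions on the parameters: they are nonzero, all expressions for the \<open>b\<close>-variables are
  finite (that is, have nonzero denominator) and nonzero, and no crossing is pinched.  Whether a
  crossing is pinched depends only on the \<open>b\<close>-variables and meridian eigenvalues.
\<close>

definition admissible ::
  "nat \<Rightarrow> complex \<Rightarrow> complex \<Rightarrow> complex \<Rightarrow> complex \<Rightarrow> complex \<Rightarrow> bool" where
  "admissible n m s p q r \<longleftrightarrow>
    p \<noteq> 0 \<and> q \<noteq> 0 \<and> r \<noteq> 0 \<and>
    (\<forall>\<sigma>\<in>segments (torus_diagram n). torus_den s r \<sigma> \<noteq> 0 \<and> torus_b m s p q r \<sigma> \<noteq> 0) \<and>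
    non_pinched (torus_diagram n) (torus_b m s p q r) (\<lambda>_. m)"

end

theory Submission
  imports Defs
begin

text \<open>
  At a non-pinched crossing the \<open>b\<close>-variables determine all four \<open>a\<close>-variables, so a coloring
  amounts to \<open>b\<close>-variables for which the two expressions for the \<open>a\<close>-variable of each segment agree.
  With $v_i = m y_i$ and $r_i = (x_{i+1} - v_i)/x_i$ this says $v_{i+1} = x_i (1 - r_{i+1})$ and that
  $\Lambda = r_i r_{i+1} / (1 - r_{i+1})$ does not depend on $i$.  Solutions $d$, $e$ of the Fibonacci
  recurrence linearise this: $x_i = e_i/d_i$, $v_i = e_{i-1}/d_{i+1}$, $r_i = s\,d_i/d_{i+1}$
  with $s^2 = \Lambda$.  Closing up after $N$ steps multiplies $d$ and $e$ by a common factor, and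
  as $x_1 \neq x_2$ the vectors $(d_2, d_1)$ and $(e_2, e_1)$ are independent; hence
  $\mathrm{Fib}_N(s) = 0$, which is the equation for $\Lambda$.
\<close>

section \<open>Linear recurrences of Fibonacci type and the equation for \<Lambda>\<close>

text \<open>The initial values are free because numerators and denominators of all
  \<open>torus_b\<close> are values of two such sequences, started at \<open>(q * s, p * r)\<close>
  and at \<open>(r, s)\<close>.\<close>

fun fib_seq :: "complex \<Rightarrow> complex \<Rightarrow> complex \<Rightarrow> nat \<Rightarrow> complex" where
  "fib_seq s u v 0 = u"
| "fib_seq s u v (Suc 0) = v"
| "fib_seq s u v (Suc (Suc k)) = s * fib_seq s u v (Suc k) + fib_seq s u v k"

lemma Fib_rec: "Fib (i + 1) s = s * Fib i s + Fib (i - 1) s"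
  by (subst fib_poly_rec) simp

lemma Fib_minus_1 [simp]: "Fib (- 1) s = 1"
  using Fib_rec[of 0 s] by simp

lemma fib_seq_Fib: "fib_seq s u v k = u * Fib (int k - 1) s + v * Fib (int k) s"
proof (induction k rule: induct_nat_012)
  case (ge2 k)
  have "Fib (int k + 2) s = s * Fib (int k + 1) s + Fib (int k) s"
    using Fib_rec[of "int k + 1" s] by (simp add: add.commute)
  moreover have "Fib (int k + 1) s = s * Fib (int k) s + Fib (int k - 1) s"
    by (rule Fib_rec)
  ultimately show ?case using ge2 by (simp add: algebra_simps)
qed auto

text \<open>At a zero of \<open>Fib (int l)\<close>, shifting by \<open>l\<close> multiplies every
  solution by the same factor \<open>Fib (int l - 1) s\<close>; this is what makes the braid close
  up.\<close>

lemma fib_seq_add: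
  "fib_seq s u v (k + l) = fib_seq s u v k * Fib (int l - 1) s + fib_seq s u v (Suc k) * Fib (int l) s"
proof -
  have "fib_seq s u v (k + l) = fib_seq s (fib_seq s u v k) (fib_seq s u v (Suc k)) l"
    by (induction l rule: induct_nat_012) auto
  then show ?thesis by (simp add: fib_seq_Fib[of s "fib_seq s u v k"])
qed

text \<open>Replacing \<open>s\<close> by \<open>- s\<close> turns the initial values
  \<open>(r, s)\<close> into \<open>(r, - s)\<close>, treated here, and
  \<open>(q * s, p * r)\<close> into \<open>(- (q * s), p * r)\<close>, treated next.\<close>

lemma fib_seq_uminus1: "fib_seq (- s) u (- v) k = (- 1) ^ k * fib_seq s u v k"
  by (induction k rule: induct_nat_012) (auto simp: algebra_simps)

lemma fib_seq_uminus2: "fib_seq (- s) (- u) v k = - ((- 1) ^ k * fib_seq s u v k)"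
  by (induction k rule: induct_nat_012) (auto simp: algebra_simps)

text \<open>Diagonal sums in Pascal's triangle. For \<open>2 * j > k\<close> the binomial
  coefficient vanishes, so the truncated exponent there is harmless.\<close>

lemma fib_seq_binomial:
  "fib_seq s 0 1 (Suc k) = (\<Sum>j\<le>k. of_nat ((k - j) choose j) * s ^ (k - 2 * j))"
proof (induction k rule: induct_nat_012)
  case (ge2 k)
  define G where "G k = (\<Sum>j\<le>k. of_nat ((k - j) choose j) * s ^ (k - 2 * j))" for k
  \<comment> \<open>The term j = 0 is split off so that Pascal's rule can later be applied to
    \<open>Suc j\<close>.\<close>
  have step: "G (Suc k) = s ^ Suc k + (\<Sum>j\<le>k. of_nat ((k - j) choose Suc j) * s ^ (k - Suc (2 * j)))" for k
    unfolding G_def by (subst sum.atMost_Suc_shift) simp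
  have "s * G (Suc k) = s ^ (k + 2) + (\<Sum>j\<le>k. of_nat ((k - j) choose Suc j) * s ^ (k - 2 * j))"
  proof -
    have summand: "s * (of_nat ((k - j) choose Suc j) * s ^ (k - Suc (2 * j)))
        = of_nat ((k - j) choose Suc j) * s ^ (k - 2 * j)" for j
    proof (cases "Suc j \<le> k - j")
      case True
      then have "k - 2 * j = Suc (k - Suc (2 * j))" by simp
      then show ?thesis by simp
    next
      case False
      then show ?thesis by (simp add: binomial_eq_0)
    qed
    then show ?thesis by (simp add: step distrib_left sum_distrib_left summand del: mult_cancel_left)
  qed
  moreover have "G (Suc (Suc k)) = s ^ (k + 2)
      + (\<Sum>j\<le>k. of_nat ((k - j) choose Suc j) * s ^ (k - 2 * j)) + G k"
  proof -
    have "G (Suc (Suc k)) = s ^ (k + 2)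
        + (\<Sum>j\<le>k. of_nat ((Suc k - j) choose Suc j) * s ^ (k - 2 * j))"
      by (simp add: step)
    \<comment> \<open>Pascal's rule.\<close>
    also have "(\<Sum>j\<le>k. of_nat ((Suc k - j) choose Suc j) * s ^ (k - 2 * j))
        = (\<Sum>j\<le>k. of_nat ((k - j) choose Suc j) * s ^ (k - 2 * j)
            + of_nat ((k - j) choose j) * s ^ (k - 2 * j))"
      by (intro sum.cong) (auto simp: Suc_diff_le algebra_simps)
    finally show ?thesis by (simp add: G_def sum.distrib)
  qed
  ultimately have "G (Suc (Suc k)) = s * G (Suc k) + G k" by simp
  then show ?case using ge2 by (simp add: G_def)
qed auto

text \<open>Fibonacci polynomials of odd index are even in \<open>s\<close>, hence polynomials in
  \<open>s\<^sup>2\<close>.\<close>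

lemma Lambda_eq_iff_Fib: "Lambda_eq n (s\<^sup>2) \<longleftrightarrow> Fib (int (2 * n + 1)) s = 0"
proof -
  have "Fib (int (2 * n + 1)) s = fib_seq s 0 1 (Suc (2 * n))"
    by (simp add: fib_seq_Fib)
  also have "\<dots> = (\<Sum>j\<le>2 * n. of_nat ((2 * n - j) choose j) * s ^ (2 * n - 2 * j))"
    by (rule fib_seq_binomial)
  also have "\<dots> = (\<Sum>j\<le>n. of_nat ((2 * n - j) choose j) * s ^ (2 * n - 2 * j))"
    by (rule sum.mono_neutral_right) (auto simp: binomial_eq_0)
  also have "\<dots> = (\<Sum>j = 0..n. of_nat ((2 * n - j) choose j) * (s\<^sup>2) ^ (n - j))"
    by (simp add: atLeast0AtMost power_mult[symmetric] diff_mult_distrib2)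
  finally show ?thesis by (simp add: Lambda_eq_def)
qed

text \<open>At 0 only the term j = n survives, and its coefficient is 1.\<close>

lemma Lambda_eq_nonzero: "Lambda_eq n L \<Longrightarrow> L \<noteq> 0"
proof
  assume "Lambda_eq n L" "L = 0"
  then have "(\<Sum>j = 0..n. if j = n then 1 else 0 :: complex) = 0"
    unfolding Lambda_eq_def by (subst (asm) sum.cong[where h = "\<lambda>j. if j = n then 1 else 0"]) 
      (auto simp: power_0_left)
  then show False by simp
qed

section \<open>The torus formulas and the diagram, indexed from 0\<close>

lemma torus_num_X: "torus_num s p q r (X (Suc k)) = fib_seq s (q * s) (p * r) (Suc k)"
  by (simp add: fib_seq_Fib)

lemma torus_num_Y: "torus_num s p q r (Y (Suc k)) = fib_seq s (q * s) (p * r) k"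
  by (simp add: fib_seq_Fib)

lemma torus_den_X: "torus_den s r (X (Suc k)) = fib_seq s r s k"
  by (simp add: fib_seq_Fib)

lemma torus_den_Y: "torus_den s r (Y (Suc k)) = fib_seq s r s (Suc k)"
  by (simp add: fib_seq_Fib)

lemmas torus_seq = torus_num_X torus_num_Y torus_den_X torus_den_Y

text \<open>Letting \<open>k\<close> range over all naturals makes the cyclic successor simply
  \<open>Suc k\<close>; the outer \<open>Suc\<close> turns residues into the labels 1, ...,
  N.\<close>

definition torus_crossing :: "nat \<Rightarrow> nat \<Rightarrow> torus_seg crossing" where
  "torus_crossing N k = PosCrossing (X (Suc (k mod N))) (Y (Suc (k mod N)))
     (X (Suc (Suc k mod N))) (Y (Suc (Suc k mod N)))"

lemma torus_diagram_eq: "torus_diagram n = range (torus_crossing (2 * n + 1))"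
proof -
  let ?N = "2 * n + 1"
  have "torus_diagram n = (\<lambda>i. PosCrossing (X i) (Y i) (X (i mod ?N + 1)) (Y (i mod ?N + 1))) ` Suc ` {..<?N}"
    by (simp add: torus_diagram_def image_Suc_lessThan del: image_Suc_atMost)
  also have "\<dots> = torus_crossing ?N ` {..<?N}"
    by (auto simp: image_image torus_crossing_def intro!: image_cong)
  also have "{..<?N} = range (\<lambda>k. k mod ?N)"
    by (auto simp: image_iff) (metis mod_less)
  also have "torus_crossing ?N ` range (\<lambda>k. k mod ?N) = range (torus_crossing ?N)"
    unfolding image_image by (intro image_cong) (auto simp: torus_crossing_def mod_Suc_eq)
  finally show ?thesis .
qed

lemma segments_torus_diagram:
  "segments (torus_diagram n) =
     (\<Union>k. {X (Suc (k mod (2 * n + 1))), Y (Suc (k mod (2 * n + 1)))})"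
  unfolding segments_def torus_diagram_eq by (fastforce simp: torus_crossing_def)

section \<open>The equations at a single crossing\<close>

text \<open>The equation for \<open>x'\<close> is linear in \<open>1 / a1\<close>, the one for
  \<open>y'\<close> is linear in \<open>a2\<close>. Once both are solved, \<open>A\<close> factors,
  and non-pinching makes all factors nonzero.\<close>

lemma crossing_equations_iff:
  fixes m x y x' y' a1 a2 a1' a2' :: complex
  assumes nz: "m \<noteq> 0" "x \<noteq> 0" "y \<noteq> 0" "x' \<noteq> 0" "y' \<noteq> 0" "a1 \<noteq> 0" "a2 \<noteq> 0"
    and np: "y \<noteq> m * x" "y \<noteq> y'" "x' \<noteq> x" "m * x' \<noteq> y'"
  shows "(let A = 1 - m * x / y * (1 - a1 / m) * (1 - 1 / (m * a2));
              B = 1 - m * a2 * (1 - y / (m * x))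
          in A \<noteq> 0 \<and> B \<noteq> 0 \<and> a1' = a1 * inverse A \<and> a2' = a2 * A \<and>
             y' = m * y / m * inverse B \<and> x' = x * (1 - m / a1 * (1 - y / (m * x))))
     \<longleftrightarrow> a1 = (m * x - y) / (x - x') \<and> a2 = x * (y' - y) / (y' * (m * x - y)) \<and>
         a1' = m * (y' - y) / (y' - m * x') \<and> a2' = x * (y' - m * x') / (m * y' * (x - x'))"
proof -
  define A where "A = 1 - m * x / y * (1 - a1 / m) * (1 - 1 / (m * a2))"
  define B where "B = 1 - m * a2 * (1 - y / (m * x))"
  have np': "m * x - y \<noteq> 0" "y' - y \<noteq> 0" "x - x' \<noteq> 0" "y' - m * x' \<noteq> 0" using np by auto
  have e1: "x' = x * (1 - m / a1 * (1 - y / (m * x))) \<longleftrightarrow> a1 = (m * x - y) / (x - x')"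
    using nz np' by (simp add: field_simps) algebra
  \<comment> \<open>Since \<open>y\<close> is nonzero, \<open>y' * B = y\<close> forces
    \<open>B\<close> to be nonzero, so the value \<open>inverse 0 = 0\<close> causes no spurious
    solution.\<close>
  have e2: "B \<noteq> 0 \<and> y' = m * y / m * inverse B \<longleftrightarrow> a2 = x * (y' - y) / (y' * (m * x - y))"
  proof -
    have "B \<noteq> 0 \<and> y' = m * y / m * inverse B \<longleftrightarrow> y' * B = y"
      using nz by (auto simp: field_simps)
    also have "\<dots> \<longleftrightarrow> a2 = x * (y' - y) / (y' * (m * x - y))"
      unfolding B_def using nz np' by (simp add: field_simps) algebra
    finally show ?thesis .
  qed
  have A: "A = (m * x - y) * (y' - m * x') / (m * (x - x') * (y' - y))"
    if "a1 = (m * x - y) / (x - x')" "a2 = x * (y' - y) / (y' * (m * x - y))"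
  proof -
    have "1 - a1 / m = (y - m * x') / (m * (x - x'))"
      unfolding that(1) using nz np' by (simp add: field_simps)
    moreover have "1 - 1 / (m * a2) = y * (y' - m * x) / (m * x * (y' - y))"
      unfolding that(2) using nz np' by (simp add: field_simps)
    ultimately have "A = 1 - (y - m * x') * (y' - m * x) / (m * (x - x') * (y' - y))"
      unfolding A_def using nz by (simp add: mult.assoc)
    also have "\<dots> = (m * x - y) * (y' - m * x') / (m * (x - x') * (y' - y))"
      using nz np' by (simp add: divide_simps) algebra
    finally show ?thesis .
  qed
  have "A \<noteq> 0 \<and> a1 * inverse A = m * (y' - y) / (y' - m * x') \<and>
      a2 * A = x * (y' - m * x') / (m * y' * (x - x'))"
    if "a1 = (m * x - y) / (x - x')" "a2 = x * (y' - y) / (y' * (m * x - y))"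
    unfolding A[OF that] unfolding that using nz np' by simp
  then show ?thesis
    unfolding Let_def A_def[symmetric] B_def[symmetric] using e1 e2 by metis
qed

lemma segments_memI:
  assumes "k \<in> D"
  shows "seg1 k \<in> segments D" "seg2 k \<in> segments D" "seg2' k \<in> segments D" "seg1' k \<in> segments D"
  using assms by (auto simp: segments_def)

lemma chi_crossing_iff:
  fixes m :: complex
  assumes "m \<noteq> 0" "b (seg1 k) \<noteq> 0" "b (seg2 k) \<noteq> 0" "b (seg1' k) \<noteq> 0" "b (seg2' k) \<noteq> 0"
    "a (seg1 k) \<noteq> 0" "a (seg2 k) \<noteq> 0"
    and "\<not> pinched b \<mu> k"
    and \<mu>: "\<mu> (seg1 k) = m" "\<mu> (seg2 k) = m" "\<mu> (seg1' k) = m" "\<mu> (seg2' k) = m"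
  shows "chi_crossing a b \<mu> k \<longleftrightarrow>
    a (seg1 k) = (m * b (seg1 k) - b (seg2 k)) / (b (seg1 k) - b (seg2' k)) \<and>
    a (seg2 k) = b (seg1 k) * (b (seg1' k) - b (seg2 k)) / (b (seg1' k) * (m * b (seg1 k) - b (seg2 k))) \<and>
    a (seg1' k) = m * (b (seg1' k) - b (seg2 k)) / (b (seg1' k) - m * b (seg2' k)) \<and>
    a (seg2' k) = b (seg1 k) * (b (seg1' k) - m * b (seg2' k)) / (m * b (seg1' k) * (b (seg1 k) - b (seg2' k)))"
proof -
  have "b (seg2 k) \<noteq> m * b (seg1 k)" "b (seg2 k) \<noteq> b (seg1' k)" "b (seg2' k) \<noteq> b (seg1 k)"
    "m * b (seg2' k) \<noteq> b (seg1' k)"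
    using assms by (auto simp: pinched_def)
  note * = crossing_equations_iff[OF assms(1-3,5,4,6,7) this, where a1' = "a (seg1' k)" and a2' = "a (seg2' k)"]
  show ?thesis
    unfolding *[symmetric] chi_crossing_def Let_def \<mu> by simp
qed

section \<open>Gluing consecutive crossings\<close>

text \<open>
  Compatibility of the two expressions for the \<open>a\<close>-variable of a segment shared by consecutive
  crossings, with \<open>b\<close>-variables \<open>x, y\<close>, then \<open>x', y'\<close>, then \<open>x'', y''\<close>.
\<close>

lemma gluing_X_iff:
  fixes m x x' y' x'' :: complex
  assumes "m \<noteq> 0" "y' \<noteq> 0" "x' \<noteq> x" "x'' \<noteq> x'" "y' \<noteq> m * x'"
  shows "(m * x' - y') / (x' - x'') = x * (y' - m * x') / (m * y' * (x - x'))
    \<longleftrightarrow> (x'' - x') * x = m * y' * (x - x')"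
proof -
  \<comment> \<open>Both expressions contain the factor \<open>w\<close>, up to sign; it is nonzero
    by non-pinching and cancels.\<close>
  define w where "w = m * x' - y'"
  have w: "w \<noteq> 0" "y' - m * x' = - w" using assms by (auto simp: w_def)
  have "w / (x' - x'') = x * - w / (m * y' * (x - x')) \<longleftrightarrow>
      w * (m * y' * (x - x')) = w * (x * (x'' - x'))"
    using assms by (subst frac_eq_eq) (auto simp: algebra_simps)
  then show ?thesis
    unfolding w(2) w_def[symmetric] using w(1) by (auto simp: mult.commute)
qed

lemma gluing_Y_iff:
  fixes m x' y y' y'' :: complex
  assumes "y'' \<noteq> 0" "y' \<noteq> m * x'"
  shows "x' * (y'' - y') / (y'' * (m * x' - y')) = m * (y' - y) / (y' - m * x')
    \<longleftrightarrow> x' * (y'' - y') = m * y'' * (y - y')"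
proof -
  define w where "w = m * x' - y'"
  have w: "w \<noteq> 0" "y' - m * x' = - w" using assms by (auto simp: w_def)
  have "x' * (y'' - y') / (y'' * w) = m * (y' - y) / - w \<longleftrightarrow>
      w * (x' * (y'' - y')) = w * (m * y'' * (y - y'))"
    using assms w(1) by (subst frac_eq_eq) (auto simp: algebra_simps)
  then show ?thesis
    unfolding w(2) w_def[symmetric] using w(1) by auto
qed

text \<open>With c = 1 this reduces periodic quantities modulo \<open>N\<close>; with general
  \<open>c\<close> it carries non-vanishing of the denominators from one period to all
  indices.\<close>

lemma multiplier_mod:
  fixes f :: "nat \<Rightarrow> 'a::comm_monoid_mult"
  assumes "\<And>k. f (k + N) = c * f k"
  shows "f k = c ^ (k div N) * f (k mod N)"
proof -
  have "f (k mod N + j * N) = c ^ j * f (k mod N)" for j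
  proof (induction j)
    case (Suc j)
    then show ?case using assms[of "k mod N + j * N"] by (simp add: ac_simps)
  qed simp
  from this[of "k div N"] show ?thesis by (simp add: add.commute)
qed

section \<open>Solving the glued recurrences\<close>

text \<open>Here \<open>x k\<close> and \<open>v k\<close> play the roles of $x_{k+1}$ and $m y_{k+1}$, continued periodically.\<close>

lemma glued_sequences:
  fixes x v :: "nat \<Rightarrow> complex"
  assumes nz: "\<And>k. x k \<noteq> 0" "\<And>k. v k \<noteq> 0"
    and neq: "\<And>k. x (Suc k) \<noteq> x k"
    and rec1: "\<And>k. (x (Suc (Suc k)) - x (Suc k)) * x k = v (Suc k) * (x k - x (Suc k))"
    and rec2: "\<And>k. x (Suc k) * (v (Suc (Suc k)) - v (Suc k)) = v (Suc (Suc k)) * (v k - v (Suc k))"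
    and per: "\<And>k. x (k + (2 * n + 1)) = x k" "\<And>k. v (k + (2 * n + 1)) = v k"
  defines "r \<equiv> (x 1 - v 0) / x 0"
  obtains L where "r \<noteq> 0" "Lambda_eq n L"
    "\<And>s k. s\<^sup>2 = L \<Longrightarrow> fib_seq s r s k \<noteq> 0"
    "\<And>s k. s\<^sup>2 = L \<Longrightarrow> x k = fib_seq s (v 0 * s) (x 0 * r) (Suc k) / fib_seq s r s k"
    "\<And>s k. s\<^sup>2 = L \<Longrightarrow> v k = fib_seq s (v 0 * s) (x 0 * r) k / fib_seq s r s (Suc k)"
proof -
  define \<rho> where "\<rho> k = (x (Suc k) - v k) / x k" for k
  have x_Suc: "x (Suc k) = v k + \<rho> k * x k" for k
    using nz(1)[of k] by (simp add: \<rho>_def)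
  \<comment> \<open>With one prime per index step, \<open>rec1\<close> rearranges to x (x'' - v') =
    x' (x - v'), that is, \<rho>' = 1 - v'/x.\<close>
  have v_Suc: "v (Suc k) = x k * (1 - \<rho> (Suc k))" for k
    using nz(1)[of k] nz(1)[of "Suc k"] rec1[of k] by (simp add: \<rho>_def field_simps) 
  have \<rho>_ne1: "1 - \<rho> (Suc k) \<noteq> 0" for k
    using v_Suc[of k] nz(2)[of "Suc k"] by auto
  have \<rho>_step: "1 - \<rho> (Suc k) = (1 - \<rho> (Suc (Suc k))) * (1 + \<rho> k - \<rho> (Suc k))" for k
  proof -
    have "x (Suc k) * v (Suc k) = v (Suc (Suc k)) * (x (Suc k) - v k + v (Suc k))"
      using rec2[of k] by algebra
    also have "x (Suc k) - v k = \<rho> k * x k" by (simp add: x_Suc)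
    finally have "(x k * x (Suc k)) * (1 - \<rho> (Suc k)) =
        (x k * x (Suc k)) * ((1 - \<rho> (Suc (Suc k))) * (1 + \<rho> k - \<rho> (Suc k)))"
      unfolding v_Suc by algebra
    then show ?thesis using nz(1) by simp
  qed
  have \<rho>_ne2: "1 + \<rho> k - \<rho> (Suc k) \<noteq> 0" for k
    using \<rho>_step[of k] \<rho>_ne1[of k] by auto
  \<comment> \<open>Zeros of \<rho> propagate in steps of two.\<close>
  have zero_iff: "\<rho> (Suc (Suc k)) = 0 \<longleftrightarrow> \<rho> k = 0" for k
  proof -
    have "\<rho> (Suc (Suc k)) * (1 + \<rho> k - \<rho> (Suc k)) = \<rho> k" using \<rho>_step[of k] by algebra
    then show ?thesis using \<rho>_ne2[of k] by auto
  qed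
  have \<rho>_per: "\<rho> (k + (2 * n + 1)) = \<rho> k" for k
    using per(1)[of k] per(1)[of "Suc k"] per(2)[of k] by (simp add: \<rho>_def)
  \<comment> \<open>If \<rho> vanished at 0, it would vanish at all even indices and, the period
    being odd, everywhere. Then \<open>x\<close> would have period 2 besides its odd period, forcing
    \<open>x 1 = x 0\<close>.\<close>
  have \<rho>0: "\<rho> 0 \<noteq> 0"
  proof
    assume 0: "\<rho> 0 = 0"
    have ev: "\<rho> (2 * k) = 0" for k by (induction k) (auto simp: 0 zero_iff)
    have "\<rho> (Suc (2 * k)) = 0 \<longleftrightarrow> \<rho> 1 = 0" for k by (induction k) (auto simp: zero_iff)
    moreover have "\<rho> (Suc (2 * n)) = 0" using \<rho>_per[of 0] 0 by simp
    ultimately have od: "\<rho> (Suc (2 * k)) = 0" for k by blast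
    have "\<rho> k = 0" for k using ev od by (metis oddE evenE Suc_eq_plus1)
    then have "x (Suc (Suc k)) = x k" for k using x_Suc[of "Suc k"] v_Suc[of k] by simp
    then have "x (Suc (2 * k)) = x 1" for k by (induction k) auto
    then have "x 1 = x 0" using per(1)[of 0] by simp
    then show False using neq[of 0] by simp
  qed
  \<comment> \<open>The index 1 is moved by one odd period to the even index 2n + 2.\<close>
  have \<rho>1: "\<rho> 1 \<noteq> 0"
  proof -
    have "\<rho> (2 * k) \<noteq> 0" for k by (induction k) (auto simp: \<rho>0 zero_iff)
    from this[of "n + 1"] show ?thesis using \<rho>_per[of 1] by simp
  qed
  have r: "r = \<rho> 0" by (simp add: r_def \<rho>_def)
  define L where "L = \<rho> 0 * \<rho> 1 / (1 - \<rho> 1)"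
  have L0: "L \<noteq> 0" using \<rho>0 \<rho>1 \<rho>_ne1[of 0] by (simp add: L_def)
  \<comment> \<open>Multiplied by \<open>t\<close>, both sides reduce to the previous
    instance.\<close>
  have L: "\<rho> k * \<rho> (Suc k) = L * (1 - \<rho> (Suc k))" for k
  proof (induction k)
    case 0
    then show ?case using \<rho>_ne1[of 0] by (simp add: L_def)
  next
    case (Suc k)
    define t where "t = 1 + \<rho> k - \<rho> (Suc k)"
    have t: "t \<noteq> 0" "(1 - \<rho> (Suc (Suc k))) * t = 1 - \<rho> (Suc k)" "\<rho> (Suc (Suc k)) * t = \<rho> k"
      using \<rho>_step[of k] \<rho>_ne2[of k] unfolding t_def by (auto simp: algebra_simps)
    have "t * (\<rho> (Suc k) * \<rho> (Suc (Suc k))) = t * (L * (1 - \<rho> (Suc (Suc k))))"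
      using Suc t(2,3) by algebra
    then show ?case using t(1) by simp
  qed
  \<comment> \<open>The invariant gives the Moebius recurrence \<rho>' (\<rho> + L) = L, which the
    substitution \<rho>_k = s d_k / d_{k+1} linearises. Two consecutive denominators are carried
    along because \<open>x k\<close> and \<open>v k\<close> involve both.\<close>
  have main: "fib_seq s r s k \<noteq> 0 \<and> fib_seq s r s (Suc k) \<noteq> 0 \<and>
      \<rho> k * fib_seq s r s (Suc k) = s * fib_seq s r s k \<and>
      x k = fib_seq s (v 0 * s) (x 0 * r) (Suc k) / fib_seq s r s k \<and>
      v k = fib_seq s (v 0 * s) (x 0 * r) k / fib_seq s r s (Suc k)"
    if s: "s\<^sup>2 = L" for s k
  proof (induction k)
    case 0
    then show ?case using s L0 \<rho>0 r by auto
  next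
    case (Suc k)
    define d where "d = fib_seq s r s"
    define e where "e = fib_seq s (v 0 * s) (x 0 * r)"
    have s0: "s \<noteq> 0" using s L0 by auto
    have d2: "d (Suc (Suc k)) = s * d (Suc k) + d k" and e2: "e (Suc (Suc k)) = s * e (Suc k) + e k"
      by (simp_all add: d_def e_def)
    have IH: "d k \<noteq> 0" "d (Suc k) \<noteq> 0" "\<rho> k * d (Suc k) = s * d k"
      "x k = e (Suc k) / d k" "v k = e k / d (Suc k)"
      using Suc by (auto simp: d_def e_def)
    have "s * (\<rho> (Suc k) * d (Suc (Suc k))) = s * (s * d (Suc k))"
      using L[of k] IH(3) s d2 by algebra
    then have \<rho>d: "\<rho> (Suc k) * d (Suc (Suc k)) = s * d (Suc k)" using s0 by simp
    then have dd: "(1 - \<rho> (Suc k)) * d (Suc (Suc k)) = d k" using d2 by algebra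
    then have dnz: "d (Suc (Suc k)) \<noteq> 0" using IH(1) by auto
    have "x (Suc k) = e (Suc (Suc k)) / d (Suc k)"
    proof -
      have "\<rho> k = s * d k / d (Suc k)" using IH(2,3) by (simp add: field_simps)
      then have "\<rho> k * x k = s * e (Suc k) / d (Suc k)" using IH(1,4) by simp
      then show ?thesis using IH by (simp add: x_Suc[of k] e2 add_divide_distrib)
    qed
    moreover have "v (Suc k) = e (Suc k) / d (Suc (Suc k))"
    proof -
      have "1 - \<rho> (Suc k) = d k / d (Suc (Suc k))" using dd dnz by (simp add: eq_divide_eq)
      then show ?thesis using IH(1) by (simp add: v_Suc IH(4))
    qed
    ultimately show ?case using \<rho>d dnz IH(2) unfolding d_def e_def by simp
  qed
  have "Lambda_eq n L"
  proof -
    define N where "N = 2 * n + 1"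
    define s where "s = csqrt L"
    have s: "s\<^sup>2 = L" by (simp add: s_def)
    define d where "d = fib_seq s r s"
    define e where "e = fib_seq s (v 0 * s) (x 0 * r)"
    define F where "F = Fib (int N) s"
    define F' where "F' = Fib (int N - 1) s"
    have dnz: "d k \<noteq> 0" and xk: "x k = e (Suc k) / d k" and \<rho>k: "\<rho> k * d (Suc k) = s * d k" for k
      using main[OF s, of k] by (auto simp: d_def e_def)
    have "\<rho> N * d (Suc N) = s * d N" "\<rho> 0 * d 1 = s * d 0" "\<rho> N = \<rho> 0"
      using \<rho>k[of N] \<rho>k[of 0] \<rho>_per[of 0] by (auto simp: N_def)
    then have "\<rho> 0 * (d (Suc N) * d 0 - d N * d 1) = 0" by algebra
    then have d_per: "d (Suc N) * d 0 = d N * d 1" using \<rho>0 by simp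
    have d_add: "d N = d 0 * F' + d 1 * F" "d (Suc N) = d 1 * F' + d 2 * F"
      using fib_seq_add[of s r s 0 N] fib_seq_add[of s r s 1 N]
      by (simp_all add: d_def F_def F'_def numeral_2_eq_2)
    have e_add: "e (Suc N) = e 1 * F' + e 2 * F"
      using fib_seq_add[of s "v 0 * s" "x 0 * r" 1 N]
      by (simp add: e_def F_def F'_def numeral_2_eq_2)
    have "x N = x 0" using per(1)[of 0] by (simp add: N_def)
    then have "e (Suc N) * d 0 = e 1 * d N" using xk[of N] xk[of 0] dnz[of N] dnz[of 0]
      by (simp add: field_simps)
    \<comment> \<open>By the addition formula the \<open>F'\<close> terms cancel, leaving
      \<open>F\<close> times a determinant. That determinant is nonzero because x_0 = e_1/d_0
      differs from x_1 = e_2/d_1.\<close>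
    then have "F * (e 2 * d 0 - e 1 * d 1) = 0" unfolding e_add d_add by algebra
    moreover have "e 2 * d 0 - e 1 * d 1 \<noteq> 0"
      using neq[of 0] xk[of 1] xk[of 0] dnz[of 1] dnz[of 0] by (auto simp: field_simps numeral_2_eq_2)
    ultimately have "F = 0" by simp
    then show ?thesis using Lambda_eq_iff_Fib[of n s] s by (simp add: F_def N_def)
  qed
  with main \<rho>0 r show ?thesis by (intro that) auto
qed

section \<open>Independence of the choice of root\<close>

text \<open>The roots differ by a sign, under which numerator and denominator pick up the same
  sign.\<close>

lemma torus_b_cong_root:
  assumes "s\<^sup>2 = t\<^sup>2" "\<sigma> \<in> segments (torus_diagram n)"
  shows "(torus_den s r \<sigma> = 0 \<longleftrightarrow> torus_den t r \<sigma> = 0) \<and>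
     torus_b m s p q r \<sigma> = torus_b m t p q r \<sigma>"
proof -
  have "(torus_den s r \<sigma> = 0 \<longleftrightarrow> torus_den (- s) r \<sigma> = 0) \<and>
     torus_b m s p q r \<sigma> = torus_b m (- s) p q r \<sigma>"
    using assms(2)
    by (auto simp: segments_torus_diagram torus_seq fib_seq_uminus1 fib_seq_uminus2
        simp del: torus_num.simps torus_den.simps fib_seq.simps)
  moreover have "t = s \<or> t = - s" using assms(1) by (metis power2_eq_iff)
  ultimately show ?thesis by auto
qed

lemma torus_crossing_sel [simp]:
  "seg1 (torus_crossing N k) = X (Suc (k mod N))" "seg2 (torus_crossing N k) = Y (Suc (k mod N))"
  "seg2' (torus_crossing N k) = X (Suc (Suc k mod N))" "seg1' (torus_crossing N k) = Y (Suc (Suc k mod N))"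
  by (simp_all add: torus_crossing_def)

lemma non_pinched_cong:
  assumes "\<And>\<sigma>. \<sigma> \<in> segments D \<Longrightarrow> b \<sigma> = b' \<sigma>" "\<And>\<sigma>. \<sigma> \<in> segments D \<Longrightarrow> \<mu> \<sigma> = \<mu>' \<sigma>"
  shows "non_pinched D b \<mu> = non_pinched D b' \<mu>'"
  unfolding non_pinched_def pinched_def using assms segments_memI by (smt (verit, best))

section \<open>From colorings to the formulas\<close>

lemma chi_coloring_imp_torus_b:
  assumes col: "chi_coloring (torus_diagram n) a b \<mu>"
    and np: "non_pinched (torus_diagram n) b \<mu>"
    and \<mu>: "\<And>\<sigma>. \<sigma> \<in> segments (torus_diagram n) \<Longrightarrow> \<mu> \<sigma> = m"
  defines "p \<equiv> b (X 1)" and "q \<equiv> m * b (Y 1)" and "r \<equiv> (b (X 2) - m * b (Y 1)) / b (X 1)"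
  assumes "n \<ge> 1" "m \<noteq> 0"
  obtains L where "Lambda_eq n L"
    "\<And>s. s\<^sup>2 = L \<Longrightarrow> admissible n m s p q r"
    "\<And>s \<sigma>. s\<^sup>2 = L \<Longrightarrow> \<sigma> \<in> segments (torus_diagram n) \<Longrightarrow> b \<sigma> = torus_b m s p q r \<sigma>"
proof -
  define N where "N = 2 * n + 1"
  define x where "x k = b (X (Suc (k mod N)))" for k
  define y where "y k = b (Y (Suc (k mod N)))" for k
  have seg: "X (Suc (k mod N)) \<in> segments (torus_diagram n)"
    "Y (Suc (k mod N)) \<in> segments (torus_diagram n)" for k
    by (auto simp: segments_torus_diagram N_def)
  have nz: "x k \<noteq> 0" "y k \<noteq> 0" "a (X (Suc (k mod N))) \<noteq> 0" "a (Y (Suc (k mod N))) \<noteq> 0" for k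
    using seg[of k] col by (auto simp: chi_coloring_def x_def y_def)
  have cr: "torus_crossing N k \<in> torus_diagram n" for k
    by (simp add: torus_diagram_eq N_def)
  have npk: "\<not> pinched b \<mu> (torus_crossing N k)" for k
    using np cr by (auto simp: non_pinched_def)
  have np': "y k \<noteq> m * x k" "y k \<noteq> y (Suc k)" "x (Suc k) \<noteq> x k" "m * x (Suc k) \<noteq> y (Suc k)" for k
    using npk[of k] \<mu> seg \<open>m \<noteq> 0\<close> by (auto simp: pinched_def x_def y_def)
  have chi: "a (X (Suc (k mod N))) = (m * x k - y k) / (x k - x (Suc k))"
    "a (Y (Suc (k mod N))) = x k * (y (Suc k) - y k) / (y (Suc k) * (m * x k - y k))"
    "a (Y (Suc (Suc k mod N))) = m * (y (Suc k) - y k) / (y (Suc k) - m * x (Suc k))"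
    "a (X (Suc (Suc k mod N))) = x k * (y (Suc k) - m * x (Suc k)) / (m * y (Suc k) * (x k - x (Suc k)))"
    for k
  proof -
    have "chi_crossing a b \<mu> (torus_crossing N k)"
      using col cr by (auto simp: chi_coloring_def)
    moreover have "b (X (Suc (k mod N))) = x k" "b (Y (Suc (k mod N))) = y k" for k
      by (simp_all add: x_def y_def)
    ultimately show "a (X (Suc (k mod N))) = (m * x k - y k) / (x k - x (Suc k))"
      "a (Y (Suc (k mod N))) = x k * (y (Suc k) - y k) / (y (Suc k) * (m * x k - y k))"
      "a (Y (Suc (Suc k mod N))) = m * (y (Suc k) - y k) / (y (Suc k) - m * x (Suc k))"
      "a (X (Suc (Suc k mod N))) = x k * (y (Suc k) - m * x (Suc k)) / (m * y (Suc k) * (x k - x (Suc k)))"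
      using chi_crossing_iff[of m b "torus_crossing N k" a \<mu>] \<open>m \<noteq> 0\<close> nz npk[of k] \<mu> seg
      by simp_all
  qed
  \<comment> \<open>The top segment between crossings \<open>k\<close> and \<open>Suc k\<close> is
    outgoing at the first and incoming at the second; its two values of \<open>a\<close> are
    equated. The bottom segment gives \<open>rec2\<close>.\<close>
  have rec1: "(x (Suc (Suc k)) - x (Suc k)) * x k = m * y (Suc k) * (x k - x (Suc k))" for k
    using chi(1)[of "Suc k"] chi(4)[of k] gluing_X_iff[of m "y (Suc k)" "x (Suc k)" "x k" "x (Suc (Suc k))"] nz np' \<open>m \<noteq> 0\<close>
    by auto
  have rec2: "x (Suc k) * (m * y (Suc (Suc k)) - m * y (Suc k)) =
      m * y (Suc (Suc k)) * (m * y k - m * y (Suc k))" for k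
  proof -
    have "x (Suc k) * (y (Suc (Suc k)) - y (Suc k)) = m * y (Suc (Suc k)) * (y k - y (Suc k))"
      using chi(2)[of "Suc k"] chi(3)[of k] gluing_Y_iff[of "y (Suc (Suc k))" "y (Suc k)" m "x (Suc k)" "y k"]
        nz np' by auto
    then show ?thesis by algebra
  qed
  \<comment> \<open>As \<open>n \<ge> 1\<close>, index 1 is not reduced modulo \<open>N\<close> and
    yields the segment \<open>X 2\<close>.\<close>
  have pqr: "x 0 = p" "m * y 0 = q" "(x 1 - q) / p = r"
    using \<open>n \<ge> 1\<close> by (simp_all add: x_def y_def p_def q_def r_def N_def numeral_2_eq_2)
  obtain L where L: "r \<noteq> 0" "Lambda_eq n L"
    "\<And>s k. s\<^sup>2 = L \<Longrightarrow> fib_seq s r s k \<noteq> 0"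
    "\<And>s k. s\<^sup>2 = L \<Longrightarrow> x k = fib_seq s (q * s) (p * r) (Suc k) / fib_seq s r s k"
    "\<And>s k. s\<^sup>2 = L \<Longrightarrow> m * y k = fib_seq s (q * s) (p * r) k / fib_seq s r s (Suc k)"
  proof (rule glued_sequences[of x "\<lambda>k. m * y k" n, unfolded pqr])
    show "x (k + (2 * n + 1)) = x k" "m * y (k + (2 * n + 1)) = m * y k" for k
      by (simp_all only: x_def y_def N_def mod_add_self2)
    show "x k \<noteq> 0" "m * y k \<noteq> 0" "x (Suc k) \<noteq> x k" for k
      using nz np' \<open>m \<noteq> 0\<close> by simp_all
  qed (rule rec1 rec2 that; assumption)+
  \<comment> \<open>Labels carry reduced indices, so the closed forms are used at
    \<open>k mod N\<close>.\<close>
  have b_eq: "b \<sigma> = torus_b m s p q r \<sigma>" "torus_den s r \<sigma> \<noteq> 0"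
    if s: "s\<^sup>2 = L" and \<sigma>: "\<sigma> \<in> segments (torus_diagram n)" for s \<sigma>
  proof -
    from \<sigma> obtain k where "\<sigma> = X (Suc (k mod N)) \<or> \<sigma> = Y (Suc (k mod N))"
      by (auto simp: segments_torus_diagram N_def)
    moreover have "x (k mod N) = x k" "y (k mod N) = y k" by (simp_all add: x_def y_def)
    ultimately show "b \<sigma> = torus_b m s p q r \<sigma>" "torus_den s r \<sigma> \<noteq> 0"
      using L(3)[OF s] L(4)[OF s, of "k mod N"] L(5)[OF s, of "k mod N"] \<open>m \<noteq> 0\<close>
      by (auto simp: torus_seq x_def y_def field_simps
          simp del: torus_num.simps torus_den.simps fib_seq.simps)
  qed
  have "admissible n m s p q r" if s: "s\<^sup>2 = L" for s
  proof -
    have "b \<sigma> \<noteq> 0" if "\<sigma> \<in> segments (torus_diagram n)" for \<sigma>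
      using that col by (auto simp: chi_coloring_def)
    moreover have "non_pinched (torus_diagram n) (torus_b m s p q r) (\<lambda>_. m)"
      using np non_pinched_cong[of "torus_diagram n" b "torus_b m s p q r" \<mu> "\<lambda>_. m"] b_eq(1)[OF s] \<mu>
      by simp
    moreover have "p \<noteq> 0" "q \<noteq> 0" using nz(1)[of 0] nz(2)[of 0] pqr \<open>m \<noteq> 0\<close> by auto
    ultimately show ?thesis
      using b_eq[OF s] L(1) by (simp add: admissible_def)
  qed
  with L(2) b_eq(1) show ?thesis by (intro that)
qed

section \<open>From the formulas to colorings\<close>

text \<open>Since \<open>Fib (int N) s = 0\<close>, going once around multiplies \<open>d\<close>
  and \<open>e\<close> by the same \<open>c\<close>, so their quotients are periodic. The incoming
  formulas define \<open>a\<close>, and the linear recurrence supplies the gluing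
  identities.\<close>

lemma admissible_imp_chi_coloring:
  assumes "Lambda_eq n (s\<^sup>2)" and adm: "admissible n m s p q r" and "n \<ge> 1" "m \<noteq> 0"
  obtains a where "chi_coloring (torus_diagram n) a (torus_b m s p q r) (\<lambda>_. m)"
    "p = torus_b m s p q r (X 1)" "q = m * torus_b m s p q r (Y 1)"
    "r = (torus_b m s p q r (X 2) - m * torus_b m s p q r (Y 1)) / torus_b m s p q r (X 1)"
proof -
  define N where "N = 2 * n + 1"
  define b where "b = torus_b m s p q r"
  define d where "d = fib_seq s r s"
  define e where "e = fib_seq s (q * s) (p * r)"
  define c where "c = Fib (int N - 1) s"
  define x where "x k = e (Suc k) / d k" for k
  define y where "y k = e k / (m * d (Suc k))" for k
  have F: "Fib (int N) s = 0" and s0: "s \<noteq> 0"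
    using assms(1) Lambda_eq_iff_Fib[of n s] Lambda_eq_nonzero[of n "s\<^sup>2"] by (auto simp: N_def)
  have pqr: "p \<noteq> 0" "q \<noteq> 0" "r \<noteq> 0" using adm by (auto simp: admissible_def)
  have d_add: "d (k + N) = c * d k" and e_add: "e (k + N) = c * e k" for k
    by (simp_all add: d_def e_def c_def fib_seq_add F)
  have seg: "X (Suc (k mod N)) \<in> segments (torus_diagram n)"
    "Y (Suc (k mod N)) \<in> segments (torus_diagram n)" for k
    by (auto simp: segments_torus_diagram N_def)
  have d_mod: "d (k mod N) \<noteq> 0" "d (Suc (k mod N)) \<noteq> 0" for k
    using adm seg[of k] unfolding admissible_def d_def torus_den_X[symmetric] torus_den_Y[symmetric]
    by auto
  \<comment> \<open>The denominator of \<open>Y N\<close> is d_N = c d_0, nonzero by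
    admissibility.\<close>
  have c0: "c \<noteq> 0"
    using d_mod(2)[of "N - 1"] d_add[of 0] by (auto simp: N_def)
  have x_add: "x (k + N) = x k" and y_add: "y (k + N) = y k" for k
    using c0 d_add[of k] d_add[of "Suc k"] e_add[of k] e_add[of "Suc k"] by (simp_all add: x_def y_def)
  have mod_per: "f (k mod N) = f k" if "\<And>k. f (k + N) = f k" for f :: "nat \<Rightarrow> complex" and k
    using multiplier_mod[of f N 1 k] that by simp
  have dnz: "d k \<noteq> 0" for k
    using multiplier_mod[of d N c k, OF d_add] c0 d_mod(1)[of k] by simp
  have b: "b (X (Suc (k mod N))) = x k" "b (Y (Suc (k mod N))) = y k" for k
    using mod_per[of x k, OF x_add] mod_per[of y k, OF y_add] \<open>m \<noteq> 0\<close>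
    by (auto simp: b_def x_def y_def d_def e_def torus_seq
        simp del: torus_num.simps torus_den.simps fib_seq.simps)
  have nz: "x k \<noteq> 0" "y k \<noteq> 0" for k
    using adm seg[of k] unfolding admissible_def b_def[symmetric] b[symmetric] by auto
  have np: "y k \<noteq> m * x k" "y k \<noteq> y (Suc k)" "x (Suc k) \<noteq> x k" "m * x (Suc k) \<noteq> y (Suc k)"
    and npk: "\<not> pinched b (\<lambda>_. m) (torus_crossing N k)" for k
  proof -
    show "\<not> pinched b (\<lambda>_. m) (torus_crossing N k)"
      using adm by (auto simp: admissible_def non_pinched_def torus_diagram_eq b_def N_def)
    then show "y k \<noteq> m * x k" "y k \<noteq> y (Suc k)" "x (Suc k) \<noteq> x k" "m * x (Suc k) \<noteq> y (Suc k)"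
      using \<open>m \<noteq> 0\<close> by (auto simp: pinched_def b)
  qed
  define \<alpha> where "\<alpha> k = (m * x k - y k) / (x k - x (Suc k))" for k
  define \<beta> where "\<beta> k = x k * (y (Suc k) - y k) / (y (Suc k) * (m * x k - y k))" for k
  \<comment> \<open>The shift \<open>i - 1\<close> undoes the labelling from 1.\<close>
  define a where "a \<sigma> = (case \<sigma> of X i \<Rightarrow> \<alpha> (i - 1) | Y i \<Rightarrow> \<beta> (i - 1))" for \<sigma>
  have \<alpha>_add: "\<alpha> (k + N) = \<alpha> k" and \<beta>_add: "\<beta> (k + N) = \<beta> k" for k
    using x_add[of k] x_add[of "Suc k"] y_add[of k] y_add[of "Suc k"] by (simp_all add: \<alpha>_def \<beta>_def)
  have a: "a (X (Suc (k mod N))) = \<alpha> k" "a (Y (Suc (k mod N))) = \<beta> k" for k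
    using mod_per[of \<alpha> k, OF \<alpha>_add] mod_per[of \<beta> k, OF \<beta>_add] by (simp_all add: a_def)
  have anz: "\<alpha> k \<noteq> 0" "\<beta> k \<noteq> 0" for k
    using np[of k] nz[of k] nz[of "Suc k"] by (auto simp: \<alpha>_def \<beta>_def)
  have d2: "d (Suc (Suc k)) = s * d (Suc k) + d k" and e2: "e (Suc (Suc k)) = s * e (Suc k) + e k" for k
    by (simp_all add: d_def e_def)
  \<comment> \<open>W_k = e_{k+2} d_k - e_{k+1} d_{k+1} changes sign at each step, so both sides
    equal -W_k e_{k+1} / (d_k d_{k+1} d_{k+2}).\<close>
  have rec1: "(x (Suc (Suc k)) - x (Suc k)) * x k = m * y (Suc k) * (x k - x (Suc k))" for k
  proof -
    define d0 d1 e0 e1 where "d0 = d k" and "d1 = d (Suc k)" and "e0 = e k" and "e1 = e (Suc k)"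
    have "d0 \<noteq> 0" "d1 \<noteq> 0" "s * d1 + d0 \<noteq> 0"
      using dnz[of k] dnz[of "Suc k"] dnz[of "Suc (Suc k)"] by (auto simp: d0_def d1_def d2)
    then show ?thesis
      using \<open>m \<noteq> 0\<close> unfolding x_def y_def d2 e2 d0_def[symmetric] d1_def[symmetric] e0_def[symmetric] e1_def[symmetric]
      by (simp add: divide_simps) algebra
  qed
  \<comment> \<open>The same argument with e_{k+1} d_{k+1} - e_k d_{k+2}, which also changes sign at
    each step.\<close>
  have rec2: "x (Suc k) * (y (Suc (Suc k)) - y (Suc k)) = m * y (Suc (Suc k)) * (y k - y (Suc k))" for k
  proof -
    define d0 d1 e0 e1 where "d0 = d k" and "d1 = d (Suc k)" and "e0 = e k" and "e1 = e (Suc k)"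
    have "d1 \<noteq> 0" "s * d1 + d0 \<noteq> 0" "s * (s * d1 + d0) + d1 \<noteq> 0"
      using dnz[of "Suc k"] dnz[of "Suc (Suc k)"] dnz[of "Suc (Suc (Suc k))"] by (auto simp: d0_def d1_def d2)
    then show ?thesis
      using \<open>m \<noteq> 0\<close> unfolding x_def y_def d2 e2 d0_def[symmetric] d1_def[symmetric] e0_def[symmetric] e1_def[symmetric]
      by (simp add: divide_simps) algebra
  qed
  have "chi_crossing a b (\<lambda>_. m) (torus_crossing N k)" for k
  proof -
    have "\<alpha> (Suc k) = x k * (y (Suc k) - m * x (Suc k)) / (m * y (Suc k) * (x k - x (Suc k)))"
      using gluing_X_iff[of m "y (Suc k)" "x (Suc k)" "x k" "x (Suc (Suc k))"] rec1[of k] nz np \<open>m \<noteq> 0\<close>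
      by (auto simp: \<alpha>_def)
    moreover have "\<beta> (Suc k) = m * (y (Suc k) - y k) / (y (Suc k) - m * x (Suc k))"
      using gluing_Y_iff[of "y (Suc (Suc k))" "y (Suc k)" m "x (Suc k)" "y k"] rec2[of k] nz np
      by (auto simp: \<beta>_def)
    ultimately show ?thesis
      using chi_crossing_iff[of m b "torus_crossing N k" a "\<lambda>_. m"] \<open>m \<noteq> 0\<close> nz anz npk[of k]
      by (simp add: a b) (simp add: \<alpha>_def \<beta>_def)
  qed
  moreover have "a \<sigma> \<noteq> 0 \<and> b \<sigma> \<noteq> 0" if "\<sigma> \<in> segments (torus_diagram n)" for \<sigma>
    using that nz anz by (auto simp: segments_torus_diagram N_def[symmetric, simplified] a b)
  ultimately have "chi_coloring (torus_diagram n) a b (\<lambda>_. m)"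
    using \<open>m \<noteq> 0\<close> by (auto simp: chi_coloring_def torus_diagram_eq N_def)
  moreover have p: "p = b (X 1)" and q: "q = m * b (Y 1)"
    using b[of 0] s0 pqr \<open>m \<noteq> 0\<close> by (simp_all add: x_def y_def d_def e_def)
  moreover have "r = (b (X 2) - m * b (Y 1)) / b (X 1)"
  proof -
    \<comment> \<open>Here e_2 = s p r + q s and d_1 = s, so x_2 = p r + q, from which
      \<open>r\<close> is recovered.\<close>
    have "b (X 2) = e 2 / d 1" using b(1)[of 1] \<open>n \<ge> 1\<close> by (simp add: x_def N_def numeral_2_eq_2)
    then have "b (X 2) = p * r + q"
      using s0 by (simp add: e_def d_def numeral_2_eq_2 add_divide_distrib)
    then show ?thesis
      unfolding p[symmetric] q[symmetric] using pqr by simp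
  qed
  ultimately show ?thesis using that unfolding b_def by blast
qed

theorem theorem5p19:
  fixes n :: nat and m :: complex
  assumes "n \<ge> 1" and "m \<noteq> 0"
  shows
    "(\<forall>a b \<mu>.
        chi_coloring (torus_diagram n) a b \<mu> \<and> non_pinched (torus_diagram n) b \<mu> \<and>
        (\<forall>\<sigma>\<in>segments (torus_diagram n). \<mu> \<sigma> = m) \<longrightarrow>
        (\<exists>\<Lambda> p q r.
           Lambda_eq n \<Lambda> \<and>
           p = b (X 1) \<and> q = m * b (Y 1) \<and> r = (b (X 2) - m * b (Y 1)) / b (X 1) \<and>
           (\<forall>s. s\<^sup>2 = \<Lambda> \<longrightarrow>
              admissible n m s p q r \<and>
              (\<forall>\<sigma>\<in>segments (torus_diagram n). b \<sigma> = torus_b m s p q r \<sigma>)))) \<and>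
     (\<forall>\<Lambda> p q r s.
        Lambda_eq n \<Lambda> \<and> s\<^sup>2 = \<Lambda> \<and> admissible n m s p q r \<longrightarrow>
        (\<exists>a b. chi_coloring (torus_diagram n) a b (\<lambda>_. m) \<and>
           non_pinched (torus_diagram n) b (\<lambda>_. m) \<and>
           (\<forall>\<sigma>\<in>segments (torus_diagram n). b \<sigma> = torus_b m s p q r \<sigma>) \<and>
           p = b (X 1) \<and> q = m * b (Y 1) \<and> r = (b (X 2) - m * b (Y 1)) / b (X 1))) \<and>
     (\<forall>\<Lambda> p q r s t. \<forall>\<sigma>\<in>segments (torus_diagram n).
        Lambda_eq n \<Lambda> \<and> s\<^sup>2 = \<Lambda> \<and> t\<^sup>2 = \<Lambda> \<longrightarrow>
        (torus_den s r \<sigma> = 0 \<longleftrightarrow> torus_den t r \<sigma> = 0) \<and>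
        torus_b m s p q r \<sigma> = torus_b m t p q r \<sigma>)"
proof (intro conjI allI impI ballI; (elim conjE)?)
  fix a b \<mu>
  assume "chi_coloring (torus_diagram n) a b \<mu>" "non_pinched (torus_diagram n) b \<mu>"
    "\<forall>\<sigma>\<in>segments (torus_diagram n). \<mu> \<sigma> = m"
  from chi_coloring_imp_torus_b[OF this(1,2) bspec[OF this(3)] assms]
  show "\<exists>\<Lambda> p q r. Lambda_eq n \<Lambda> \<and> p = b (X 1) \<and> q = m * b (Y 1) \<and>
      r = (b (X 2) - m * b (Y 1)) / b (X 1) \<and>
      (\<forall>s. s\<^sup>2 = \<Lambda> \<longrightarrow> admissible n m s p q r \<and>
         (\<forall>\<sigma>\<in>segments (torus_diagram n). b \<sigma> = torus_b m s p q r \<sigma>))"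
    by metis
next
  fix \<Lambda> p q r s
  assume "Lambda_eq n \<Lambda>" "s\<^sup>2 = \<Lambda>" and adm: "admissible n m s p q r"
  then have "Lambda_eq n (s\<^sup>2)" by simp
  from admissible_imp_chi_coloring[OF this adm assms] adm
  show "\<exists>a b. chi_coloring (torus_diagram n) a b (\<lambda>_. m) \<and>
      non_pinched (torus_diagram n) b (\<lambda>_. m) \<and>
      (\<forall>\<sigma>\<in>segments (torus_diagram n). b \<sigma> = torus_b m s p q r \<sigma>) \<and>
      p = b (X 1) \<and> q = m * b (Y 1) \<and> r = (b (X 2) - m * b (Y 1)) / b (X 1)"
    unfolding admissible_def by metis
qed (use torus_b_cong_root in metis)+

end
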